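(* For every fixed $d\in\mathbb N$, \[ \frac{d!}{d^d}\le\liminf_{\delta\downarrow0}\delta^dN(d,\delta)\le\limsup_{\delta\downarrow0}\delta^dN(d,\delta)\le 1 . \]
   Context: For $\boldsymbol x=(x_1,\dots,x_d)\in[0,1]^d$ put $V(\boldsymbol x)=\prod_{j=1}^d x_j$; $\boldsymbol x\le\boldsymbol y$ means $x_j\le y_j$ for all $j$. A finite set $\Gamma\subset[0,1]^d$ is a $\delta$-cover if for every $\boldsymbol z\in[0,1]^d$ there are $\boldsymbol x,\boldsymbol y\in\Gamma\cup\{\boldsymbol 0\}$ with $\boldsymbol x\le\boldsymbol z\le\boldsymbol y$ and $V(\boldsymbol y)-V(\boldsymbol x)\le\delta$; $N(d,\delta)$ is the minimum cardinality $|\Gamma|$ of a $\delta$-cover. *)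

theory Defs
  imports "HOL-Analysis.Analysis"
begin

text \<open>
  Dimension \<open>d\<close> is \<open>CARD('d)\<close>, hence automatically at least 1.  On \<^typ>\<open>real ^ 'd\<close> the order is
  componentwise and \<open>1\<close> is the all-ones vector, so \<open>{0..1}\<close> is the closed unit cube.
\<close>

definition V :: "real ^ 'd \<Rightarrow> real"
  where "V x = (\<Prod>j\<in>UNIV. x $ j)"

text \<open>The origin is available as a lower corner even when it is not an element of \<open>\<Gamma>\<close>.\<close>

definition delta_cover :: "real \<Rightarrow> (real ^ 'd) set \<Rightarrow> bool"
  where "delta_cover \<delta> \<Gamma> \<longleftrightarrow>
    finite \<Gamma> \<and> \<Gamma> \<subseteq> {0..1} \<and>
    (\<forall>z\<in>{0..1}. \<exists>x\<in>\<Gamma> \<union> {0}. \<exists>y\<in>\<Gamma> \<union> {0}. x \<le> z \<and> z \<le> y \<and> V y - V x \<le> \<delta>)"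

text \<open>
  The minimum is meaningful for \<open>\<delta> > 0\<close>, where \<open>\<delta>\<close>-covers exist.
\<close>

definition cover_number :: "'d::finite itself \<Rightarrow> real \<Rightarrow> nat"
  where "cover_number _ \<delta> = (LEAST n. \<exists>\<Gamma> :: (real ^ 'd) set. delta_cover \<delta> \<Gamma> \<and> card \<Gamma> = n)"

end

theory Submission
  imports Defs
begin

text \<open>
  Near a point \<open>z\<close>, a box with sides \<open>h\<^sub>j\<close> changes \<open>V\<close> by about \<open>V(z) \<Sum>\<^sub>j h\<^sub>j / z\<^sub>j\<close>.  Both bounds come from
  comparing volumes under this constraint, with the weight \<open>V\<^sup>d\<^sup>-\<^sup>1\<close>, whose integral over the unit cube
  is \<open>d\<^sup>-\<^sup>d\<close>.

  Lower bound.  The points \<open>z\<close> that can have \<open>y\<close> as upper corner satisfy \<open>z \<le> y\<close> and \<open>V(z) \<ge> V(y) - \<delta>\<close>.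
  This set is asymptotically a simplex, and its \<open>V\<^sup>d\<^sup>-\<^sup>1\<close>-weighted volume is at most \<open>\<delta>\<^sup>d / d!\<close> for every
  \<open>y\<close> (lemma \<open>slice_mass_le\<close>).  Since the sets belonging to a cover exhaust the cube up to a null set,
  \<open>\<delta>\<^sup>d N(d,\<delta>) \<ge> d! / d\<^sup>d\<close> for every \<open>\<delta> > 0\<close> and not only in the limit (lemma \<open>card_delta_cover_ge\<close>).

  Upper bound.  Among the boxes that change \<open>V\<close> by \<open>\<delta>\<close>, the one with \<open>h\<^sub>j = \<delta> z\<^sub>j / (d V(z))\<close> has the
  largest volume, namely \<open>(\<delta> / d)\<^sup>d V(z)\<^sup>1\<^sup>-\<^sup>d\<close>.  Tiling with such boxes takes about
  \<open>(d / \<delta>)\<^sup>d \<integral> V\<^sup>d\<^sup>-\<^sup>1 = \<delta>\<^sup>-\<^sup>d\<close> of them, and about as many grid points.  To make this rigorous, the step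
  sizes are held constant on the cells of a coarse grid of mesh \<open>1 / m\<close>
  (lemma \<open>delta_cover_of_adapted_grids\<close>).  For fixed \<open>m\<close> the limit \<open>\<delta> \<rightarrow> 0\<close> removes the effect of
  rounding and of the shared cell boundaries and leaves an upper Riemann sum, which is at most
  \<open>(1 + 1 / m)\<^bsup>d d\<^esup>\<close>; then \<open>m \<rightarrow> \<infinity>\<close>.
\<close>

section \<open>Lower bound: a weighted volume argument\<close>

text \<open>
  Near \<open>y\<close> the set of \<open>z \<le> y\<close> with \<open>\<Prod>y - \<Prod>z \<le> \<delta>\<close> looks like a simplex with legs
  \<open>\<delta> y\<^sub>i / \<Prod>y\<close>, hence with volume \<open>\<delta>\<^sup>n (\<Prod>y)\<^sup>1\<^sup>-\<^sup>n / n!\<close> where \<open>n = card I\<close>; the weight \<open>(\<Prod>z)\<^sup>n\<^sup>-\<^sup>1\<close> makes this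
  independent of \<open>y\<close>.  The estimate is exact, without error term, by Fubini and induction on \<open>I\<close>.
  Split off a coordinate \<open>t = z\<^sub>i\<close> and let \<open>Y\<close> be the product of the other \<open>y\<^sub>j\<close> and \<open>k = n - 1\<close> their number.
  The constraint on the other coordinates is again of the same form, with
  \<open>\<epsilon> = (\<delta> - (y\<^sub>i - t) Y) / t\<close> for \<open>\<delta>\<close>.  Bounding one factor \<open>\<Prod>\<^bsub>j\<noteq>i\<^esub> z\<^sub>j\<close> of the weight by \<open>Y\<close>
  lowers the exponent to the one in the induction hypothesis, and the powers of \<open>t\<close> cancel.
  What remains is the integral of \<open>Y (\<delta> - (y\<^sub>i - t) Y)\<^sup>k / k!\<close> over \<open>t\<close>, which is elementary.
\<close>
lemma slice_mass_le:
  fixes y :: "'i \<Rightarrow> real"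
  assumes "finite I" and "\<delta> \<ge> 0"
  shows "(\<integral>\<^sup>+z. (if (\<forall>i\<in>I. 0 < z i \<and> z i \<le> y i) \<and> (\<Prod>i\<in>I. y i) - (\<Prod>i\<in>I. z i) \<le> \<delta>
                then ennreal ((\<Prod>i\<in>I. z i) ^ (card I - 1)) else 0) \<partial>PiM I (\<lambda>_. lborel))
         \<le> ennreal (\<delta> ^ card I / fact (card I))"
  using assms
proof (induction I arbitrary: \<delta> rule: finite_induct)
  case empty
  show ?case
    using empty by (simp add: PiM_empty nn_integral_count_space_finite)
next
  case (insert i I)
  interpret product_sigma_finite "\<lambda>_::'i. lborel :: real measure" ..
  note [simp, intro] = \<open>finite I\<close>
  define k where "k = card I"
  define Y where "Y = (\<Prod>j\<in>I. y j)"
  define slice where "slice J \<epsilon> z \<longleftrightarrow>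
    (\<forall>j\<in>J. 0 < z j \<and> z j \<le> y j) \<and> (\<Prod>j\<in>J. y j) - (\<Prod>j\<in>J. z j) \<le> \<epsilon>" for J \<epsilon> and z :: "'i \<Rightarrow> real"
  define density where
    "density J \<epsilon> z = (if slice J \<epsilon> z then ennreal ((\<Prod>j\<in>J. z j) ^ (card J - 1)) else 0)"
    for J \<epsilon> and z :: "'i \<Rightarrow> real"
  have meas: "density J \<epsilon> \<in> borel_measurable (PiM J (\<lambda>_. lborel))" if "finite J" for J \<epsilon>
    unfolding density_def slice_def using that by measurable
  have IH: "(\<integral>\<^sup>+z. density I \<epsilon> z \<partial>PiM I (\<lambda>_. lborel)) \<le> ennreal (\<epsilon> ^ k / fact k)" if "\<epsilon> \<ge> 0" for \<epsilon>
    using insert.IH[OF that] by (simp add: density_def slice_def k_def)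
  have "(\<integral>\<^sup>+z. density (insert i I) \<delta> z \<partial>PiM (insert i I) (\<lambda>_. lborel))
      \<le> ennreal (\<delta> ^ Suc k / fact (Suc k))"
  proof (cases "\<forall>j\<in>insert i I. 0 < y j")
    case False
    then have "\<not> slice (insert i I) \<delta> z" for z
      unfolding slice_def by (meson less_le_trans)
    then have "density (insert i I) \<delta> z = 0" for z
      by (simp add: density_def)
    then show ?thesis by simp
  next
    case True
    then have "Y > 0" by (auto simp: Y_def intro: prod_pos)
    have inner: "(\<integral>\<^sup>+x. density (insert i I) \<delta> (x(i := t)) \<partial>PiM I (\<lambda>_. lborel))
        \<le> ennreal (Y * (\<delta> - (y i - t) * Y) ^ k / fact k) * indicator {y i - \<delta> / Y .. y i} t" for t
    proof -
      have ins: "(\<Prod>j\<in>insert i I. (x(i := t)) j) = t * (\<Prod>j\<in>I. x j)" for x :: "'i \<Rightarrow> real"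
      proof -
        have "(\<Prod>j\<in>I. (x(i := t)) j) = (\<Prod>j\<in>I. x j)"
          using insert.hyps by (intro prod.cong) auto
        then show ?thesis using insert.hyps by simp
      qed
      have sliceD: "0 < t \<and> t \<le> y i \<and> (\<forall>j\<in>I. 0 < x j \<and> x j \<le> y j)
          \<and> y i * Y - t * (\<Prod>j\<in>I. x j) \<le> \<delta> \<and> 0 < (\<Prod>j\<in>I. x j) \<and> (\<Prod>j\<in>I. x j) \<le> Y"
        if "slice (insert i I) \<delta> (x(i := t))" for x
      proof -
        have "0 < t" "t \<le> y i" using that by (auto simp: slice_def)
        moreover have I: "\<forall>j\<in>I. 0 < x j \<and> x j \<le> y j"
        proof
          fix j assume "j \<in> I"
          then have "j \<noteq> i" "j \<in> insert i I" using insert.hyps by auto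
          then show "0 < x j \<and> x j \<le> y j" using that unfolding slice_def by (metis fun_upd_other)
        qed
        moreover have "y i * Y - t * (\<Prod>j\<in>I. x j) \<le> \<delta>"
          using that insert.hyps unfolding slice_def ins by (simp add: Y_def)
        moreover have "0 < (\<Prod>j\<in>I. x j)" using I by (intro prod_pos) auto
        moreover have "(\<Prod>j\<in>I. x j) \<le> Y" unfolding Y_def using I by (intro prod_mono) auto
        ultimately show ?thesis by blast
      qed
      show ?thesis
      proof (cases "0 < t \<and> t \<le> y i \<and> (y i - t) * Y \<le> \<delta>")
        case False
        have "\<not> slice (insert i I) \<delta> (x(i := t))" for x
        proof
          assume "slice (insert i I) \<delta> (x(i := t))"
          note * = sliceD[OF this]
          then have "t * (\<Prod>j\<in>I. x j) \<le> t * Y" by simp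
          then have "y i * Y - t * Y \<le> \<delta>" using * by linarith
          with * False show False by (simp add: left_diff_distrib)
        qed
        then show ?thesis by (simp add: density_def)
      next
        case t: True
        \<comment> \<open>the tolerance left for the other coordinates once \<open>z i = t\<close> is fixed\<close>
        define \<epsilon> where "\<epsilon> = (\<delta> - (y i - t) * Y) / t"
        have "\<epsilon> \<ge> 0" using t by (simp add: \<epsilon>_def)
        have "density (insert i I) \<delta> (x(i := t)) \<le> ennreal (t ^ k * Y) * density I \<epsilon> x" for x
        proof (cases "slice (insert i I) \<delta> (x(i := t))")
          case True
          note * = sliceD[OF True]
          have "slice I \<epsilon> x"
            using * t by (auto simp: slice_def \<epsilon>_def field_simps Y_def)
          \<comment> \<open>\<open>k - 1\<close> truncates for \<open>k = 0\<close>, where both products are empty\<close>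
          moreover have "(\<Prod>j\<in>I. x j) ^ k \<le> (\<Prod>j\<in>I. x j) ^ (k - 1) * Y"
          proof (cases "k = 0")
            case True
            then have "I = {}" by (simp add: k_def)
            then show ?thesis using True by (simp add: Y_def)
          next
            case False
            then have "(\<Prod>j\<in>I. x j) ^ k = (\<Prod>j\<in>I. x j) ^ (k - 1) * (\<Prod>j\<in>I. x j)"
              by (metis power_minus_mult zero_less_iff_neq_zero)
            then show ?thesis using * by (simp add: mult_left_mono)
          qed
          then have "(t * (\<Prod>j\<in>I. x j)) ^ k \<le> t ^ k * Y * (\<Prod>j\<in>I. x j) ^ (k - 1)"
            using t by (simp add: power_mult_distrib mult_ac mult_left_mono)
          ultimately show ?thesis
            using True insert.hyps t \<open>Y > 0\<close>
            by (simp add: density_def ins[unfolded prod.insert[OF insert.hyps]] k_def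
                ennreal_mult'[symmetric] ennreal_leI del: fun_upd_apply)
        qed (simp add: density_def)
        then have "(\<integral>\<^sup>+x. density (insert i I) \<delta> (x(i := t)) \<partial>PiM I (\<lambda>_. lborel))
            \<le> (\<integral>\<^sup>+x. ennreal (t ^ k * Y) * density I \<epsilon> x \<partial>PiM I (\<lambda>_. lborel))"
          by (intro nn_integral_mono)
        also have "\<dots> = ennreal (t ^ k * Y) * (\<integral>\<^sup>+x. density I \<epsilon> x \<partial>PiM I (\<lambda>_. lborel))"
          by (intro nn_integral_cmult meas) simp
        also have "\<dots> \<le> ennreal (t ^ k * Y) * ennreal (\<epsilon> ^ k / fact k)"
          by (intro mult_left_mono IH \<open>\<epsilon> \<ge> 0\<close>) simp
        also have "\<dots> = ennreal (t ^ k * Y * (\<epsilon> ^ k / fact k))"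
          using t \<open>Y > 0\<close> by (intro ennreal_mult'[symmetric]) simp
        also have "t ^ k * Y * (\<epsilon> ^ k / fact k) = Y * (\<delta> - (y i - t) * Y) ^ k / fact k"
          using t by (simp add: \<epsilon>_def power_divide)
        finally have "(\<integral>\<^sup>+x. density (insert i I) \<delta> (x(i := t)) \<partial>PiM I (\<lambda>_. lborel))
            \<le> ennreal (Y * (\<delta> - (y i - t) * Y) ^ k / fact k)" .
        moreover have "t \<in> {y i - \<delta> / Y .. y i}"
          using t \<open>Y > 0\<close> by (simp add: field_simps)
        ultimately show ?thesis by (simp only: indicator_simps mult_1_right)
      qed
    qed
    have "(\<integral>\<^sup>+z. density (insert i I) \<delta> z \<partial>PiM (insert i I) (\<lambda>_. lborel))
        = (\<integral>\<^sup>+t. (\<integral>\<^sup>+x. density (insert i I) \<delta> (x(i := t)) \<partial>PiM I (\<lambda>_. lborel)) \<partial>lborel)"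
      using insert.hyps by (intro product_nn_integral_insert_rev meas) auto
    also have "\<dots> \<le> (\<integral>\<^sup>+t. ennreal (Y * (\<delta> - (y i - t) * Y) ^ k / fact k)
        * indicator {y i - \<delta> / Y .. y i} t \<partial>lborel)"
      by (intro nn_integral_mono inner)
    also have "\<dots> = ennreal ((\<delta> - (y i - y i) * Y) ^ Suc k / fact (Suc k)
        - (\<delta> - (y i - (y i - \<delta> / Y)) * Y) ^ Suc k / fact (Suc k))"
    proof (rule nn_integral_FTC_Icc)
      fix t assume t: "t \<in> {y i - \<delta> / Y .. y i}"
      have "((\<lambda>t. \<delta> - (y i - t) * Y) has_real_derivative Y) (at t)"
        by (auto intro!: derivative_eq_intros)
      from DERIV_cdivide[OF DERIV_power_Suc[OF this], of k "fact (Suc k)"]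
      have "((\<lambda>t. (\<delta> - (y i - t) * Y) ^ Suc k / fact (Suc k)) has_real_derivative
          real (Suc k) * (Y * (\<delta> - (y i - t) * Y) ^ k) / fact (Suc k)) (at t)"
        by (simp only: of_nat_Suc)
      moreover have "real (Suc k) * c / fact (Suc k) = c / fact k" for c :: real
        by (simp add: field_simps del: of_nat_Suc)
      ultimately show "((\<lambda>t. (\<delta> - (y i - t) * Y) ^ Suc k / fact (Suc k)) has_real_derivative
          Y * (\<delta> - (y i - t) * Y) ^ k / fact k) (at t)"
        by (simp only:)
      show "0 \<le> Y * (\<delta> - (y i - t) * Y) ^ k / fact k"
        using t \<open>Y > 0\<close> by (auto intro!: mult_nonneg_nonneg divide_nonneg_nonneg zero_le_power simp: field_simps)
    qed (use \<open>\<delta> \<ge> 0\<close> \<open>Y > 0\<close> in auto)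
    also have "\<dots> = ennreal (\<delta> ^ Suc k / fact (Suc k))"
      using \<open>Y > 0\<close> by simp
    finally show ?thesis .
  qed
  then show ?case
    using insert.hyps by (simp add: density_def slice_def k_def)
qed

lemma unit_cube_mass:
  fixes I :: "'i set"
  assumes "finite I" and "n > 0"
  shows "(\<integral>\<^sup>+z. (if \<forall>i\<in>I. 0 < z i \<and> z i \<le> 1 then ennreal ((\<Prod>i\<in>I. z i) ^ (n - 1)) else 0)
      \<partial>PiM I (\<lambda>_. lborel)) = ennreal (1 / real n ^ card I)"
proof -
  interpret product_sigma_finite "\<lambda>_::'i. lborel :: real measure" ..
  have "(if \<forall>i\<in>I. 0 < z i \<and> z i \<le> 1 then ennreal ((\<Prod>i\<in>I. z i) ^ (n - 1)) else 0)
      = (\<Prod>i\<in>I. ennreal (z i ^ (n - 1)) * indicator {0<..1} (z i))" for z :: "'i \<Rightarrow> real"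
  proof (cases "\<forall>i\<in>I. 0 < z i \<and> z i \<le> 1")
    case True
    have "(\<Prod>i\<in>I. ennreal (z i ^ (n - 1)) * indicator {0<..1} (z i)) = (\<Prod>i\<in>I. ennreal (z i ^ (n - 1)))"
      using True by (intro prod.cong) auto
    also have "\<dots> = ennreal (\<Prod>i\<in>I. z i ^ (n - 1))"
      using True by (intro prod_ennreal) (simp add: less_imp_le)
    finally show ?thesis using True by (simp add: prod_power_distrib)
  next
    case False
    then have "\<exists>i\<in>I. ennreal (z i ^ (n - 1)) * indicator {0<..1} (z i) = 0"
      by (auto simp: indicator_def)
    then have "(\<Prod>i\<in>I. ennreal (z i ^ (n - 1)) * indicator {0<..1} (z i)) = 0"
      using \<open>finite I\<close> by (intro prod_zero)
    then show ?thesis by (simp only: False if_False)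
  qed
  then have "?thesis \<longleftrightarrow> (\<integral>\<^sup>+z. (\<Prod>i\<in>I. ennreal (z i ^ (n - 1)) * indicator {0<..1} (z i))
      \<partial>PiM I (\<lambda>_. lborel)) = ennreal (1 / real n ^ card I)"
    by simp
  also have "(\<integral>\<^sup>+z. (\<Prod>i\<in>I. ennreal (z i ^ (n - 1)) * indicator {0<..1} (z i)) \<partial>PiM I (\<lambda>_. lborel))
      = (\<Prod>i\<in>I. \<integral>\<^sup>+t. ennreal (t ^ (n - 1)) * indicator {0<..1::real} t \<partial>lborel)"
    using \<open>finite I\<close> by (intro product_nn_integral_prod) measurable
  also have "(\<integral>\<^sup>+t. ennreal (t ^ (n - 1)) * indicator {0<..1::real} t \<partial>lborel) = ennreal (1 / real n)"
  proof -
    have "(\<integral>\<^sup>+t. ennreal (t ^ (n - 1)) * indicator {0<..1::real} t \<partial>lborel)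
        = (\<integral>\<^sup>+t. ennreal (t ^ (n - 1)) * indicator {0..1::real} t \<partial>lborel)"
      using AE_lborel_singleton[of "0::real"]
      by (intro nn_integral_cong_AE) (auto elim!: eventually_mono simp: indicator_def)
    also have "\<dots> = ennreal (1 ^ n / real n - 0 ^ n / real n)"
      using \<open>n > 0\<close> by (intro nn_integral_FTC_Icc) (auto intro!: derivative_eq_intros)
    finally show ?thesis using \<open>n > 0\<close> by (simp add: zero_power)
  qed
  finally show ?thesis
    by (simp add: ennreal_power power_divide)
qed

text \<open>
  Every \<open>z\<close> with positive coordinates lies below some \<open>y \<in> \<Gamma>\<close> with \<open>V y - V z \<le> \<delta>\<close>, because \<open>V\<close> is
  monotone and the lower corner lies below \<open>z\<close>.  So the slices attached to the points of \<open>\<Gamma>\<close>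
  exhaust the mass \<open>d\<^sup>-\<^sup>d\<close> of the cube, while each carries at most \<open>\<delta>\<^sup>d / d!\<close>.  Restricting to
  positive coordinates excludes the origin as an upper corner, which is why \<open>card \<Gamma>\<close> appears and
  not \<open>card (\<Gamma> \<union> {0})\<close>.
\<close>
lemma card_delta_cover_ge:
  fixes \<Gamma> :: "(real ^ 'd) set"
  assumes "delta_cover \<delta> \<Gamma>" and "\<delta> \<ge> 0"
  shows "fact CARD('d) / real CARD('d) ^ CARD('d) \<le> \<delta> ^ CARD('d) * real (card \<Gamma>)"
proof -
  define d where "d = CARD('d)"
  define M where "M = PiM (UNIV :: 'd set) (\<lambda>_. lborel :: real measure)"
  define f where "f y z = (if (\<forall>j. 0 < z j \<and> z j \<le> y $ j) \<and> V y - (\<Prod>j\<in>UNIV. z j) \<le> \<delta>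
      then ennreal ((\<Prod>j\<in>UNIV. z j) ^ (d - 1)) else 0)" for y :: "real ^ 'd" and z :: "'d \<Rightarrow> real"
  have "d > 0" by (simp add: d_def)
  have "finite \<Gamma>" using assms by (simp add: delta_cover_def)
  have meas: "f y \<in> borel_measurable M" for y
    unfolding f_def M_def by measurable
  have cov: "(if \<forall>j\<in>UNIV. 0 < z j \<and> z j \<le> 1 then ennreal ((\<Prod>j\<in>UNIV. z j) ^ (d - 1)) else 0)
      \<le> (\<Sum>y\<in>\<Gamma>. f y z)" (is "?g z \<le> _") for z :: "'d \<Rightarrow> real"
  proof (cases "\<forall>j. 0 < z j \<and> z j \<le> 1")
    case True
    define v :: "real ^ 'd" where "v = (\<chi> j. z j)"
    have "v \<in> {0..1}" using True by (simp add: v_def less_eq_vec_def less_imp_le)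
    then obtain x y where x: "x \<in> \<Gamma> \<union> {0}" and y: "y \<in> \<Gamma> \<union> {0}"
      and xy: "x \<le> v" "v \<le> y" "V y - V x \<le> \<delta>"
      using assms(1) unfolding delta_cover_def by blast
    have zy: "0 < z j" "z j \<le> y $ j" for j
      using True xy(2) by (auto simp: v_def less_eq_vec_def)
    have "0 < y $ j" for j using zy[of j] by linarith
    then have "y \<noteq> 0" by auto
    with y have "y \<in> \<Gamma>" by blast
    have "x \<in> {0..1}" using x assms(1) by (auto simp: delta_cover_def less_eq_vec_def)
    then have "V x \<le> (\<Prod>j\<in>UNIV. z j)"
      unfolding V_def using xy(1) by (intro prod_mono) (auto simp: v_def less_eq_vec_def)
    then have "f y z = ?g z"
      using zy True xy(3) by (simp add: f_def)
    moreover have "f y z \<le> (\<Sum>y\<in>\<Gamma>. f y z)"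
      using \<open>y \<in> \<Gamma>\<close> \<open>finite \<Gamma>\<close> by (intro member_le_sum) auto
    ultimately show ?thesis by simp
  qed auto
  have "ennreal (1 / real d ^ d) = (\<integral>\<^sup>+z. ?g z \<partial>M)"
    unfolding M_def using unit_cube_mass[of "UNIV :: 'd set" d] \<open>d > 0\<close> by (simp add: d_def)
  also have "\<dots> \<le> (\<integral>\<^sup>+z. (\<Sum>y\<in>\<Gamma>. f y z) \<partial>M)"
    by (intro nn_integral_mono cov)
  also have "\<dots> = (\<Sum>y\<in>\<Gamma>. \<integral>\<^sup>+z. f y z \<partial>M)"
    by (intro nn_integral_sum meas)
  also have "\<dots> \<le> (\<Sum>y\<in>\<Gamma>. ennreal (\<delta> ^ d / fact d))"
  proof (rule sum_mono)
    fix y :: "real ^ 'd"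
    show "(\<integral>\<^sup>+z. f y z \<partial>M) \<le> ennreal (\<delta> ^ d / fact d)"
      using slice_mass_le[of "UNIV :: 'd set" \<delta> "\<lambda>j. y $ j"] \<open>\<delta> \<ge> 0\<close>
      unfolding f_def M_def V_def d_def by simp
  qed
  also have "\<dots> = ennreal (real (card \<Gamma>) * (\<delta> ^ d / fact d))"
    using \<open>\<delta> \<ge> 0\<close> by (subst ennreal_mult') (simp_all add: ennreal_of_nat_eq_real_of_nat)
  finally have "1 / real d ^ d \<le> real (card \<Gamma>) * (\<delta> ^ d / fact d)"
    using \<open>\<delta> \<ge> 0\<close> by (simp add: ennreal_le_iff)
  then show ?thesis
    using \<open>d > 0\<close> by (simp add: d_def[symmetric] field_simps)
qed

section \<open>Upper bound: grids adapted to the local size of V\<close>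

text \<open>
  Discrete form of \<open>dV = V \<Sum> dz\<^sub>i / z\<^sub>i\<close>: change the coordinates one at a time and bound each
  factor left alone by \<open>w\<close>.
\<close>
lemma prod_diff_le:
  fixes x y w :: "'i \<Rightarrow> real"
  assumes "finite I" and "\<And>i. i \<in> I \<Longrightarrow> 0 \<le> x i \<and> x i \<le> y i \<and> y i \<le> w i \<and> 0 < w i"
  shows "(\<Prod>i\<in>I. y i) - (\<Prod>i\<in>I. x i) \<le> (\<Prod>i\<in>I. w i) * (\<Sum>i\<in>I. (y i - x i) / w i)"
  using assms
proof (induction I rule: finite_induct)
  case (insert i I)
  let ?x = "\<Prod>i\<in>I. x i" and ?y = "\<Prod>i\<in>I. y i" and ?w = "\<Prod>i\<in>I. w i"
    and ?s = "\<Sum>i\<in>I. (y i - x i) / w i"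
  have i: "0 \<le> x i" "x i \<le> y i" "y i \<le> w i" "0 < w i" using insert.prems[of i] by auto
  have IH: "?y - ?x \<le> ?w * ?s" using insert by auto
  have "?x \<le> ?y" "?y \<le> ?w" "0 \<le> ?y"
    using insert.prems by (auto intro!: prod_mono prod_nonneg intro: order_trans)
  have "y i * ?y - x i * ?x = (y i - x i) * ?y + x i * (?y - ?x)"
    by (simp add: algebra_simps)
  also have "\<dots> \<le> (y i - x i) * ?w + w i * (?w * ?s)"
    using i \<open>?x \<le> ?y\<close> \<open>?y \<le> ?w\<close> \<open>0 \<le> ?y\<close> IH by (intro add_mono mult_mono) auto
  also have "\<dots> = w i * ?w * ((y i - x i) / w i + ?s)"
    using i by (simp add: field_simps)
  finally show ?case using insert.hyps by simp
qed simp

lemma unit_interval_grid: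
  fixes u :: real
  assumes "n > 0" and "0 \<le> u" and "u \<le> 1"
  shows "\<exists>i<n. real i / real n \<le> u \<and> u \<le> (real i + 1) / real n"
proof (cases "u = 1")
  case True
  show ?thesis
    by (rule exI[of _ "n - 1"]) (use assms True in \<open>auto simp: of_nat_diff\<close>)
next
  case False
  define i where "i = nat \<lfloor>u * real n\<rfloor>"
  have eq: "real i = of_int \<lfloor>u * real n\<rfloor>" using assms by (simp add: i_def)
  have le: "real i \<le> u * real n" "u * real n \<le> real i + 1" unfolding eq by linarith+
  have "u * real n < real n" using False assms by simp
  then have "i < n" using le by linarith
  then show ?thesis by (rule exI[of _ i, OF conjI]) (use le assms in \<open>auto simp: field_simps\<close>)
qed

text \<open>
  Cut the cube into \<open>m\<^sup>d\<close> equal cells; the cell with index \<open>k\<close> has upper corner \<open>(w (k j))\<^sub>j\<close>.  Inside it,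
  with \<open>W = \<Prod>\<^sub>j w (k j)\<close>, use a regular grid whose step in direction \<open>j\<close> is at most \<open>\<delta> w (k j) / (d W)\<close>.
  Between opposite corners of a grid box each direction then contributes at most \<open>\<delta> / d\<close> to the change
  of \<open>V\<close>.  In each direction the cell has at most \<open>d W / (m \<delta> w (k j)) + 1\<close> steps, from rounding up,
  and one more grid point than steps.
\<close>
lemma delta_cover_of_adapted_grids:
  fixes m :: nat and \<delta> :: real
  assumes "m > 0" and "\<delta> > 0"
  defines "w \<equiv> \<lambda>i. real (i + 1) / real m"
  obtains \<Gamma> :: "(real ^ 'd) set" where "delta_cover \<delta> \<Gamma>"
    and "real (card \<Gamma>) \<le> (\<Sum>k\<in>PiE (UNIV :: 'd set) (\<lambda>_. {..<m}). \<Prod>j\<in>UNIV.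
      real CARD('d) * (\<Prod>i\<in>UNIV. w (k i)) / (real m * \<delta> * w (k j)) + 2)"
proof -
  define d where "d = CARD('d)"
  define K where "K = PiE (UNIV :: 'd set) (\<lambda>_. {..<m})"
  define W where "W k = (\<Prod>i\<in>UNIV. w (k i))" for k :: "'d \<Rightarrow> nat"
  define n where "n k j = nat \<lceil>real d * W k / (real m * \<delta> * w (k j))\<rceil>" for k :: "'d \<Rightarrow> nat" and j
  define point :: "('d \<Rightarrow> nat) \<Rightarrow> ('d \<Rightarrow> nat) \<Rightarrow> real ^ 'd"
    where "point k i = (\<chi> j. (real (k j) + real (i j) / real (n k j)) / real m)" for k i
  define \<Gamma> where "\<Gamma> = (\<Union>k\<in>K. point k ` PiE UNIV (\<lambda>j. {..n k j}))"
  have "d > 0" by (simp add: d_def)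
  have w_pos: "0 < w i" for i using assms by (simp add: w_def)
  have W_pos: "0 < W k" for k unfolding W_def using w_pos by (intro prod_pos) auto
  have arg_pos: "0 < real d * W k / (real m * \<delta> * w (k j))" for k j
    using assms W_pos w_pos \<open>d > 0\<close> by simp
  have n_ge: "real d * W k / (real m * \<delta> * w (k j)) \<le> real (n k j)" for k j
    unfolding n_def using real_nat_ceiling_ge .
  have n_le: "real (n k j) \<le> real d * W k / (real m * \<delta> * w (k j)) + 1" for k j
    unfolding n_def using arg_pos[of k j] by linarith
  have n_pos: "n k j > 0" for k j
    using n_ge[of k j] arg_pos[of k j] by (metis less_le_trans of_nat_0_less_iff)
  have "finite K" unfolding K_def by (intro finite_PiE) auto
  have fin: "finite (PiE UNIV (\<lambda>j. {..n k j}))" for k by (intro finite_PiE) auto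
  have "finite \<Gamma>" using \<open>finite K\<close> fin by (simp add: \<Gamma>_def)
  have "\<Gamma> \<subseteq> {0..1}"
  proof
    fix v assume "v \<in> \<Gamma>"
    then obtain k i where k: "k \<in> K" and i: "i \<in> PiE UNIV (\<lambda>j. {..n k j})" and v: "v = point k i"
      by (auto simp: \<Gamma>_def)
    have "0 \<le> v $ j \<and> v $ j \<le> 1" for j
    proof -
      have "real (k j) + 1 \<le> real m" using k by (simp add: K_def PiE_iff nat_less_real_le)
      moreover have "real (i j) / real (n k j) \<le> 1" using i n_pos[of k j] by (auto simp: PiE_iff)
      ultimately have "real (k j) + real (i j) / real (n k j) \<le> real m" by linarith
      then show ?thesis using assms by (simp add: v point_def)
    qed
    then show "v \<in> {0..1}" by (simp add: less_eq_vec_def)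
  qed
  moreover have "\<exists>x\<in>\<Gamma>. \<exists>y\<in>\<Gamma>. x \<le> z \<and> z \<le> y \<and> V y - V x \<le> \<delta>"
    if z: "z \<in> {0..1}" for z :: "real ^ 'd"
  proof -
    have "\<exists>i<m. real i / real m \<le> z $ j \<and> z $ j \<le> (real i + 1) / real m" for j
      using unit_interval_grid[OF \<open>m > 0\<close>, of "z $ j"] z by (auto simp: less_eq_vec_def)
    then obtain k0 where k0: "\<And>j. k0 j < m \<and> real (k0 j) / real m \<le> z $ j \<and> z $ j \<le> (real (k0 j) + 1) / real m"
      by metis
    have "\<exists>i<n k0 j. real i / real (n k0 j) \<le> real m * z $ j - real (k0 j)
        \<and> real m * z $ j - real (k0 j) \<le> (real i + 1) / real (n k0 j)" for j
      using unit_interval_grid[OF n_pos[of k0 j], of "real m * z $ j - real (k0 j)"] k0[of j] \<open>m > 0\<close>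
      by (auto simp: field_simps)
    then obtain i where i: "\<And>j. i j < n k0 j \<and> real (i j) / real (n k0 j) \<le> real m * z $ j - real (k0 j)
        \<and> real m * z $ j - real (k0 j) \<le> (real (i j) + 1) / real (n k0 j)"
      by metis
    define x where "x = point k0 i"
    define y where "y = point k0 (\<lambda>j. i j + 1)"
    have "k0 \<in> K" using k0 by (auto simp: K_def)
    moreover have "i \<in> PiE UNIV (\<lambda>j. {..n k0 j})" "(\<lambda>j. i j + 1) \<in> PiE UNIV (\<lambda>j. {..n k0 j})"
      using i by (auto simp: less_imp_le Suc_le_eq)
    ultimately have "x \<in> \<Gamma>" "y \<in> \<Gamma>" unfolding x_def y_def \<Gamma>_def by blast+
    moreover have "x \<le> z" "z \<le> y"
    proof -
      have "x $ j \<le> z $ j \<and> z $ j \<le> y $ j" for j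
      proof -
        have "real (k0 j) + real (i j) / real (n k0 j) \<le> real m * z $ j"
          "real m * z $ j \<le> real (k0 j) + real (i j + 1) / real (n k0 j)"
          using i[of j] by (simp_all add: add.commute)
        then show ?thesis
          using \<open>m > 0\<close> by (simp add: x_def y_def point_def pos_divide_le_eq pos_le_divide_eq mult.commute)
      qed
      then show "x \<le> z" "z \<le> y" by (auto simp: less_eq_vec_def)
    qed
    moreover have "V y - V x \<le> \<delta>"
    proof -
      have diff: "y $ j - x $ j = 1 / (real m * real (n k0 j))" for j
        using n_pos[of k0 j] \<open>m > 0\<close> by (simp add: x_def y_def point_def field_simps)
      have step: "W k0 * ((y $ j - x $ j) / w (k0 j)) \<le> \<delta> / real d" for j
      proof -
        have "real d * W k0 \<le> real (n k0 j) * (real m * \<delta> * w (k0 j))"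
          using n_ge[of k0 j] assms w_pos by (simp add: pos_divide_le_eq)
        then show ?thesis
          using n_pos[of k0 j] \<open>m > 0\<close> \<open>d > 0\<close> w_pos[of "k0 j"] by (simp add: diff field_simps)
      qed
      have "0 \<le> x $ j \<and> x $ j \<le> y $ j \<and> y $ j \<le> w (k0 j) \<and> 0 < w (k0 j)" for j
      proof -
        have "real (i j + 1) / real (n k0 j) \<le> 1" using i[of j] by auto
        then have "y $ j \<le> w (k0 j)"
          using \<open>m > 0\<close> by (simp add: y_def point_def w_def divide_right_mono)
        moreover have "0 \<le> x $ j" by (simp add: x_def point_def)
        moreover have "0 \<le> y $ j - x $ j" unfolding diff by simp
        ultimately show ?thesis using w_pos by simp
      qed
      then have "V y - V x \<le> W k0 * (\<Sum>j\<in>UNIV. (y $ j - x $ j) / w (k0 j))"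
        unfolding V_def W_def by (intro prod_diff_le) auto
      also have "\<dots> = (\<Sum>j\<in>UNIV. W k0 * ((y $ j - x $ j) / w (k0 j)))"
        by (rule sum_distrib_left)
      also have "\<dots> \<le> (\<Sum>j\<in>(UNIV :: 'd set). \<delta> / real d)" by (intro sum_mono step)
      also have "\<dots> = \<delta>" using \<open>d > 0\<close> by (simp add: d_def)
      finally show ?thesis .
    qed
    ultimately show ?thesis by blast
  qed
  ultimately have "delta_cover \<delta> \<Gamma>"
    using \<open>finite \<Gamma>\<close> unfolding delta_cover_def by blast
  moreover have "real (card \<Gamma>) \<le> (\<Sum>k\<in>K. \<Prod>j\<in>UNIV. real d * W k / (real m * \<delta> * w (k j)) + 2)"
  proof -
    have "card \<Gamma> \<le> (\<Sum>k\<in>K. card (point k ` PiE UNIV (\<lambda>j. {..n k j})))"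
      unfolding \<Gamma>_def by (rule card_UN_le[OF \<open>finite K\<close>])
    also have "\<dots> \<le> (\<Sum>k\<in>K. card (PiE UNIV (\<lambda>j. {..n k j})))"
      using fin by (intro sum_mono card_image_le)
    also have "\<dots> = (\<Sum>k\<in>K. \<Prod>j\<in>UNIV. n k j + 1)"
      by (simp add: card_PiE)
    finally have "real (card \<Gamma>) \<le> real (\<Sum>k\<in>K. \<Prod>j\<in>UNIV. n k j + 1)"
      by (simp only: of_nat_le_iff)
    also have "\<dots> = (\<Sum>k\<in>K. \<Prod>j\<in>UNIV. real (n k j) + 1)"
      by (simp add: add.commute)
    also have "\<dots> \<le> (\<Sum>k\<in>K. \<Prod>j\<in>UNIV. real d * W k / (real m * \<delta> * w (k j)) + 2)"
    proof (intro sum_mono prod_mono conjI)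
      fix k j show "real (n k j) + 1 \<le> real d * W k / (real m * \<delta> * w (k j)) + 2"
        using n_le[of k j] by linarith
    qed simp
    finally show ?thesis .
  qed
  ultimately show ?thesis by (rule that[unfolded K_def[symmetric] W_def[symmetric] d_def[symmetric]])
qed

text \<open>
  Each summand is at most the increment of \<open>x\<^sup>d\<close> over the next unit interval, by Bernoulli's
  inequality, so the sum telescopes.
\<close>
lemma sum_derivative_power_le:
  assumes "d > 0"
  shows "(\<Sum>i<m. real d * real (i + 1) ^ (d - 1)) \<le> real (m + 1) ^ d"
proof (induction m)
  case (Suc m)
  define a where "a = real (m + 1)"
  have "a > 0" by (simp add: a_def)
  have "a ^ d * (1 + real d * (1 / a)) \<le> a ^ d * (1 + 1 / a) ^ d"
    using \<open>a > 0\<close> by (intro mult_left_mono Bernoulli_inequality) (auto intro: order_trans[of _ 0])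
  also have "\<dots> = (a + 1) ^ d"
    using \<open>a > 0\<close> by (simp add: power_mult_distrib[symmetric] field_simps)
  also have "a ^ d * (1 + real d * (1 / a)) = a ^ d + real d * a ^ (d - 1)"
    using \<open>a > 0\<close> \<open>d > 0\<close> by (simp add: field_simps power_eq_if)
  finally show ?case using Suc by (simp add: a_def add_ac)
qed simp

text \<open>
  The left-hand side is the limit of \<open>\<delta>\<^sup>d\<close> times the number of grid points, counted cell by cell, as \<open>\<delta> \<rightarrow> 0\<close>.  In a cell
  the product of the \<open>d W / (m w (k j))\<close> is \<open>(d / m)\<^sup>d W\<^sup>d\<^sup>-\<^sup>1\<close>, a product over the coordinates, so the sum
  over all cells is the \<open>d\<close>-th power of an upper Riemann sum for \<open>\<integral>\<^sub>0\<^sup>1 d t\<^sup>d\<^sup>-\<^sup>1 dt = 1\<close>.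
\<close>
lemma adapted_grids_leading_term:
  fixes m :: nat
  assumes "m > 0"
  defines "w \<equiv> \<lambda>i. real (i + 1) / real m"
  shows "(\<Sum>k\<in>PiE (UNIV :: 'd::finite set) (\<lambda>_. {..<m}). \<Prod>j\<in>UNIV.
      real CARD('d) * (\<Prod>i\<in>UNIV. w (k i)) / (real m * w (k j)))
    \<le> (1 + 1 / real m) ^ (CARD('d) * CARD('d))"
proof -
  define d where "d = CARD('d)"
  have "d > 0" by (simp add: d_def)
  have w_pos: "0 < w i" for i using assms by (simp add: w_def)
  have "(\<Prod>j\<in>UNIV. real d * (\<Prod>i\<in>UNIV. w (k i)) / (real m * w (k j)))
      = (\<Prod>j\<in>UNIV. real d / real m * w (k j) ^ (d - 1))" for k :: "'d \<Rightarrow> nat"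
  proof -
    define W where "W = (\<Prod>i\<in>UNIV. w (k i))"
    have "W > 0" unfolding W_def using w_pos by (intro prod_pos) auto
    have "(\<Prod>j\<in>UNIV. real d * W / (real m * w (k j))) = (real d * W) ^ d / (real m ^ d * W)"
      by (simp add: prod_dividef prod.distrib W_def[symmetric] d_def)
    also have "\<dots> = (real d / real m) ^ d * W ^ (d - 1)"
      using \<open>W > 0\<close> \<open>d > 0\<close> by (simp add: power_mult_distrib power_divide power_eq_if[of W])
    also have "\<dots> = (\<Prod>j\<in>UNIV. real d / real m * w (k j) ^ (d - 1))"
      by (simp add: prod.distrib prod_power_distrib W_def d_def del: times_divide_eq_left)
    finally show ?thesis by (simp add: W_def)
  qed
  then have "(\<Sum>k\<in>PiE (UNIV :: 'd set) (\<lambda>_. {..<m}). \<Prod>j\<in>UNIV.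
        real d * (\<Prod>i\<in>UNIV. w (k i)) / (real m * w (k j)))
      = (\<Sum>k\<in>PiE (UNIV :: 'd set) (\<lambda>_. {..<m}). \<Prod>j\<in>UNIV. real d / real m * w (k j) ^ (d - 1))"
    by simp
  also have "\<dots> = (\<Prod>j\<in>(UNIV :: 'd set). \<Sum>i<m. real d / real m * w i ^ (d - 1))"
    by (subst prod_sum_PiE) auto
  also have "\<dots> = (\<Sum>i<m. real d / real m * w i ^ (d - 1)) ^ d"
    by (simp add: d_def)
  also have "\<dots> \<le> ((1 + 1 / real m) ^ d) ^ d"
  proof (rule power_mono)
    have "(\<Sum>i<m. real d / real m * w i ^ (d - 1)) = (\<Sum>i<m. real d * real (i + 1) ^ (d - 1)) / real m ^ d"
      using \<open>d > 0\<close> by (simp add: w_def power_divide sum_divide_distrib power_eq_if[of "real m" d])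
    also have "\<dots> \<le> real (m + 1) ^ d / real m ^ d"
      by (intro divide_right_mono sum_derivative_power_le \<open>d > 0\<close>) simp
    also have "\<dots> = (1 + 1 / real m) ^ d"
      using \<open>m > 0\<close> by (simp add: power_divide[symmetric] add_divide_distrib add.commute)
    finally show "(\<Sum>i<m. real d / real m * w i ^ (d - 1)) \<le> (1 + 1 / real m) ^ d" .
    show "0 \<le> (\<Sum>i<m. real d / real m * w i ^ (d - 1))"
      using w_pos by (intro sum_nonneg) (simp add: less_imp_le)
  qed
  finally show ?thesis by (simp add: power_mult d_def)
qed

section \<open>The covering number\<close>

lemma cover_number_attained:
  fixes \<delta> :: real
  assumes "\<delta> > 0"
  obtains \<Gamma> :: "(real ^ 'd) set"
    where "delta_cover \<delta> \<Gamma>" and "card \<Gamma> = cover_number TYPE('d::finite) \<delta>"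
proof -
  have "\<exists>n. \<exists>\<Gamma> :: (real ^ 'd) set. delta_cover \<delta> \<Gamma> \<and> card \<Gamma> = n"
    by (rule delta_cover_of_adapted_grids[of 1 \<delta>]) (use assms in auto)
  from LeastI_ex[OF this] show ?thesis
    using that unfolding cover_number_def by blast
qed

lemma cover_number_le:
  fixes \<Gamma> :: "(real ^ 'd::finite) set"
  assumes "delta_cover \<delta> \<Gamma>"
  shows "cover_number TYPE('d) \<delta> \<le> card \<Gamma>"
  unfolding cover_number_def using assms by (intro Least_le) blast

lemma Limsup_cover_number_le:
  fixes m :: nat
  assumes "m > 0"
  shows "Limsup (at_right 0) (\<lambda>\<delta>. ereal (\<delta> ^ CARD('d) * real (cover_number TYPE('d::finite) \<delta>)))
    \<le> ereal ((1 + 1 / real m) ^ (CARD('d) * CARD('d)))"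
proof -
  define w where "w i = real (i + 1) / real m" for i
  define g where "g \<delta> = (\<Sum>k\<in>PiE (UNIV :: 'd set) (\<lambda>_. {..<m}). \<Prod>j\<in>UNIV.
      real CARD('d) * (\<Prod>i\<in>UNIV. w (k i)) / (real m * w (k j)) + 2 * \<delta>)" for \<delta>
  have "\<delta> ^ CARD('d) * real (cover_number TYPE('d) \<delta>) \<le> g \<delta>" if "\<delta> > 0" for \<delta>
  proof -
    obtain \<Gamma> :: "(real ^ 'd) set" where \<Gamma>: "delta_cover \<delta> \<Gamma>"
      and card: "real (card \<Gamma>) \<le> (\<Sum>k\<in>PiE (UNIV :: 'd set) (\<lambda>_. {..<m}). \<Prod>j\<in>UNIV.
        real CARD('d) * (\<Prod>i\<in>UNIV. w (k i)) / (real m * \<delta> * w (k j)) + 2)"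
      using delta_cover_of_adapted_grids[OF \<open>m > 0\<close> \<open>\<delta> > 0\<close>] unfolding w_def by blast
    have "\<delta> ^ CARD('d) * real (cover_number TYPE('d) \<delta>) \<le> \<delta> ^ CARD('d) * real (card \<Gamma>)"
      using cover_number_le[OF \<Gamma>] \<open>\<delta> > 0\<close> by simp
    also have "\<dots> \<le> \<delta> ^ CARD('d) * (\<Sum>k\<in>PiE (UNIV :: 'd set) (\<lambda>_. {..<m}). \<Prod>j\<in>UNIV.
        real CARD('d) * (\<Prod>i\<in>UNIV. w (k i)) / (real m * \<delta> * w (k j)) + 2)"
      using card \<open>\<delta> > 0\<close> by (intro mult_left_mono) auto
    also have "\<dots> = (\<Sum>k\<in>PiE (UNIV :: 'd set) (\<lambda>_. {..<m}). \<Prod>j\<in>UNIV.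
        \<delta> * (real CARD('d) * (\<Prod>i\<in>UNIV. w (k i)) / (real m * \<delta> * w (k j)) + 2))"
      by (simp add: sum_distrib_left prod.distrib)
    also have "\<dots> = g \<delta>"
      unfolding g_def using \<open>\<delta> > 0\<close> by (intro sum.cong prod.cong refl) (simp add: distrib_left)
    finally show ?thesis .
  qed
  then have "Limsup (at_right 0) (\<lambda>\<delta>. ereal (\<delta> ^ CARD('d) * real (cover_number TYPE('d) \<delta>)))
      \<le> Limsup (at_right 0) (\<lambda>\<delta>. ereal (g \<delta>))"
    by (intro Limsup_mono) (simp add: eventually_mono[OF eventually_at_right_less])
  also have "\<dots> = ereal (g 0)"
  proof (rule lim_imp_Limsup)
    have "(g \<longlongrightarrow> g 0) (at_right 0)"
      unfolding g_def by (intro tendsto_intros)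
    then show "((\<lambda>\<delta>. ereal (g \<delta>)) \<longlongrightarrow> ereal (g 0)) (at_right 0)" by simp
  qed simp
  also have "\<dots> \<le> ereal ((1 + 1 / real m) ^ (CARD('d) * CARD('d)))"
    using adapted_grids_leading_term[OF \<open>m > 0\<close>, where 'd = 'd] by (simp add: g_def w_def)
  finally show ?thesis .
qed

theorem theorem1p3:
  fixes N :: "real \<Rightarrow> nat" and d :: nat
  defines "N \<equiv> cover_number TYPE('d::finite)" and "d \<equiv> CARD('d)"
  shows "ereal (fact d / real d ^ d) \<le> Liminf (at_right 0) (\<lambda>\<delta>. ereal (\<delta> ^ d * real (N \<delta>)))
    \<and> Liminf (at_right 0) (\<lambda>\<delta>. ereal (\<delta> ^ d * real (N \<delta>)))
        \<le> Limsup (at_right 0) (\<lambda>\<delta>. ereal (\<delta> ^ d * real (N \<delta>)))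
    \<and> Limsup (at_right 0) (\<lambda>\<delta>. ereal (\<delta> ^ d * real (N \<delta>))) \<le> 1"
proof (intro conjI)
  have "fact d / real d ^ d \<le> \<delta> ^ d * real (N \<delta>)" if "\<delta> > 0" for \<delta>
  proof -
    obtain \<Gamma> :: "(real ^ 'd) set" where "delta_cover \<delta> \<Gamma>" "card \<Gamma> = N \<delta>"
      unfolding N_def using cover_number_attained[OF \<open>\<delta> > 0\<close>] .
    with card_delta_cover_ge[of \<delta> \<Gamma>] \<open>\<delta> > 0\<close> show ?thesis by (simp add: d_def)
  qed
  then show "ereal (fact d / real d ^ d) \<le> Liminf (at_right 0) (\<lambda>\<delta>. ereal (\<delta> ^ d * real (N \<delta>)))"
    by (intro Liminf_bounded eventually_mono[OF eventually_at_right_less]) simp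
  show "Liminf (at_right 0) (\<lambda>\<delta>. ereal (\<delta> ^ d * real (N \<delta>)))
      \<le> Limsup (at_right 0) (\<lambda>\<delta>. ereal (\<delta> ^ d * real (N \<delta>)))"
    by (intro Liminf_le_Limsup) simp
  have "(\<lambda>n. (1 + inverse (real (Suc n))) ^ (d * d)) \<longlonglongrightarrow> 1 ^ (d * d)"
    by (intro tendsto_power LIMSEQ_inverse_real_of_nat_add)
  then have "(\<lambda>n. ereal ((1 + inverse (real (Suc n))) ^ (d * d))) \<longlonglongrightarrow> 1"
    by (simp add: one_ereal_def)
  then show "Limsup (at_right 0) (\<lambda>\<delta>. ereal (\<delta> ^ d * real (N \<delta>))) \<le> 1"
  proof (rule LIMSEQ_le_const, intro exI allI impI)
    fix n
    show "Limsup (at_right 0) (\<lambda>\<delta>. ereal (\<delta> ^ d * real (N \<delta>)))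
        \<le> ereal ((1 + inverse (real (Suc n))) ^ (d * d))"
      using Limsup_cover_number_le[of "Suc n", where 'd = 'd]
      by (simp add: N_def d_def divide_inverse del: of_nat_Suc)
  qed
qed

end
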